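(* A skew-symmetric graph $G$ is strongly connected and weakly acyclic if and only if it admits a strong separator $(A,B)$.
   Context: All graphs are finite; parallel arcs are allowed. A skew-symmetric graph is a digraph $G$ (node set $V_G$, arc set $A_G$) endowed with an involution $\sigma$ on $V_G\cup A_G$, mapping nodes to nodes and arcs to arcs, with no fixed nodes and no fixed arcs, such that for each arc $a$ from $u$ to $v$, $\sigma(a)$ is an arc from $\sigma(v)$ to $\sigma(u)$. We write $x'=\sigma(x)$ (the mate of $x$) and $X'=\sigma(X)$ for a set $X$ of nodes; $X$ is self-symmetric if $X'=X$. $G[X]$ is the directed subgraph induced by $X$; if $X'=X$ it is a skew-symmetric graph with the restricted symmetry. A path (circuit) is a node-simple directed walk (cycle). A path or circuit is regular if it contains no pair of arcs $a,a'$ that are mates. $G$ is weakly acyclic if it has no regular circuits. $G$ is strongly connected in the standard directed sense: each two nodes are connected by a (not necessarily regular) path. A skew-symmetric graph $H$ with a node $s$ is called $s$-connected if every node of $H$ lies on a (not necessarily regular) path from $s$ to $s'$ in $H$. A strong separator for $G$ is a partition $(A,B)$ of $V_G$ such that: (i) $A$ and $B$ are self-symmetric; (ii) exactly one pair of symmetric arcs connects $A$ and $B$, namely an arc from $a'$ to $b$ and its mate, an arc from $b'$ to $a$, where $a,a'\in A$ and $b,b'\in B$; (iii) $G[A]$ is weakly acyclic and $a$-connected, and $G[B]$ is weakly acyclic and $b$-connected.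
   Formalization: In "s-connected", the path from s to s' through a node may repeat nodes (a directed walk), since with node-simple paths the "only if" direction is false; and a strongly connected graph is taken to have at least one node. *)

theory Defs
  imports "Graph_Theory.Graph_Theory"
begin

(* fin_digraph: finitely many nodes and arcs, with parallel arcs and loops allowed.
   The involution is split into its action nmate on nodes and amate on arcs;
   their values outside verts G and arcs G are irrelevant. *)
locale skew_symmetric_graph = fin_digraph G
  for G :: "('a, 'b) pre_digraph" (structure)
  and nmate :: "'a \<Rightarrow> 'a" and amate :: "'b \<Rightarrow> 'b" +
  assumes nmate_in_verts: "v \<in> verts G \<Longrightarrow> nmate v \<in> verts G"
    and nmate_nmate: "v \<in> verts G \<Longrightarrow> nmate (nmate v) = v"
    and nmate_neq: "v \<in> verts G \<Longrightarrow> nmate v \<noteq> v"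
    and amate_in_arcs: "e \<in> arcs G \<Longrightarrow> amate e \<in> arcs G"
    and amate_amate: "e \<in> arcs G \<Longrightarrow> amate (amate e) = e"
    and amate_neq: "e \<in> arcs G \<Longrightarrow> amate e \<noteq> e"
    and tail_amate: "e \<in> arcs G \<Longrightarrow> tail G (amate e) = nmate (head G e)"
    and head_amate: "e \<in> arcs G \<Longrightarrow> head G (amate e) = nmate (tail G e)"

definition regular :: "('b \<Rightarrow> 'b) \<Rightarrow> 'b list \<Rightarrow> bool" where
  "regular amate p \<longleftrightarrow> (\<forall>e \<in> set p. amate e \<notin> set p)"

(* pre_digraph.cycle is node-simple and nonempty, and includes loops and 2-cycles. *)
definition weakly_acyclic :: "('a, 'b) pre_digraph \<Rightarrow> ('b \<Rightarrow> 'b) \<Rightarrow> bool" where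
  "weakly_acyclic G amate \<longleftrightarrow> \<not> (\<exists>p. pre_digraph.cycle G p \<and> regular amate p)"

definition self_symmetric :: "('a \<Rightarrow> 'a) \<Rightarrow> 'a set \<Rightarrow> bool" where
  "self_symmetric nmate X \<longleftrightarrow> nmate ` X = X"

(* The directed walk from s to its mate through x may repeat nodes. Demanding one
   node-simple path through x would be too strong for the characterization of strongly
   connected weakly acyclic graphs by strong separators. For example, take the nodes
   t, t', s, s', a, a', b, b' with two parallel arcs each from t to t', from a to a' and
   from b to b', and the arcs s' -> t, s -> a, a' -> b with their mates
   t' -> s, a' -> s', b' -> a. The graph is strongly connected and weakly acyclic, but
   for each of the three candidate partitions (one for each connecting pair) one side has
   nodes that no node-simple path between the required end nodes visits. *)
definition s_connected :: "('a, 'b) pre_digraph \<Rightarrow> ('a \<Rightarrow> 'a) \<Rightarrow> 'a \<Rightarrow> bool" where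
  "s_connected H nmate s \<longleftrightarrow> s \<in> verts H \<and>
     (\<forall>x \<in> verts H. \<exists>p. pre_digraph.awalk H s p (nmate s) \<and>
        x \<in> set (pre_digraph.awalk_verts H s p))"

definition arcs_between :: "('a, 'b) pre_digraph \<Rightarrow> 'a set \<Rightarrow> 'a set \<Rightarrow> 'b set" where
  "arcs_between G A B = {e \<in> arcs G.
     (tail G e \<in> A \<and> head G e \<in> B) \<or> (tail G e \<in> B \<and> head G e \<in> A)}"

(* The arc e goes from the mate of a to b, so its mate goes from the mate of b to a. *)
definition strong_separator ::
  "('a, 'b) pre_digraph \<Rightarrow> ('a \<Rightarrow> 'a) \<Rightarrow> ('b \<Rightarrow> 'b) \<Rightarrow> 'a set \<Rightarrow> 'a set \<Rightarrow> bool" where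
  "strong_separator G nmate amate A B \<longleftrightarrow>
     A \<union> B = verts G \<and> A \<inter> B = {} \<and>
     self_symmetric nmate A \<and> self_symmetric nmate B \<and>
     (\<exists>a \<in> A. \<exists>b \<in> B. \<exists>e \<in> arcs G.
        tail G e = nmate a \<and> head G e = b \<and>
        arcs_between G A B = {e, amate e} \<and>
        weakly_acyclic (G \<restriction> A) amate \<and> s_connected (G \<restriction> A) nmate a \<and>
        weakly_acyclic (G \<restriction> B) amate \<and> s_connected (G \<restriction> B) nmate b)"

end

theory Submission
  imports Defs
begin

text \<open>
  Call a walk regular if it contains no arc together with its mate, and let
  \<open>e \<prec> f\<close> mean that some regular walk \<open>P\<close> leads from the arc \<open>e\<close> to the arc \<open>f\<close> such that
  regular walks starting with \<open>f\<close> avoid \<open>P\<close> and its mate from then on. In a weakly acyclic graph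
  this is a strict order, because the walks witnessing \<open>e \<prec> f\<close> and \<open>f \<prec> g\<close> can be concatenated.
  Let \<open>f\<close> be maximal and \<open>Y\<close> the set of arcs reachable from \<open>f\<close> by regular walks. A walk \<open>P\<close> from
  \<open>f\<close> to \<open>g \<in> Y\<close> does not witness \<open>f \<prec> g\<close>, so some regular walk starting with \<open>g\<close> returns to \<open>P\<close>
  or its mate; the former would close a regular circuit, and in the latter case, following \<open>P\<close> up
  to that place and then the mate of the returning walk shows that the mate of \<open>g\<close> lies in \<open>Y\<close>.
  Thus \<open>Y\<close> is self-symmetric, and the heads of \<open>f\<close> and of the arcs in \<open>Y\<close> form a set whose only
  connections to the other nodes are \<open>f\<close> and its mate.
\<close>

section \<open>Walks, circuits and induced subgraphs of digraphs\<close>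

lemma regular_mono: "regular m q \<Longrightarrow> set p \<subseteq> set q \<Longrightarrow> regular m p"
  by (auto simp: regular_def)

context wf_digraph
begin

lemma awalk_append_iff_ex: "awalk u (p @ q) v \<longleftrightarrow> (\<exists>w. awalk u p w \<and> awalk w q v)"
  by (metis awalk_append_iff awalk_ends awalk_Nil_iff awalk_appendI)

lemma awalk_snoc_iff: "awalk u (p @ [e]) v \<longleftrightarrow> awalk u p (tail G e) \<and> e \<in> arcs G \<and> v = head G e"
  by (auto simp: awalk_append_iff_ex awalk_simps simp del: awalk_append_iff)

text \<open>The first arc is split off and the rest, which leads from its head to its tail, is
  shortened to a path. Together they form a circuit.\<close>

lemma closed_awalk_imp_cycle:
  assumes "awalk u p u" "p \<noteq> []"
  obtains q where "cycle q" "set q \<subseteq> set p"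
proof -
  obtain e p' where p: "p = e # p'" using assms(2) by (cases p) auto
  then have e: "e \<in> arcs G" and u: "u = tail G e" and w: "awalk (head G e) p' (tail G e)"
    using assms(1) by (auto simp: awalk_Cons_iff)
  define q where "q = awalk_to_apath p'"
  have q: "apath (head G e) q (tail G e)" "set q \<subseteq> set p'"
    using apath_awalk_to_apath[OF w] awalk_to_apath_subset[OF w] by (auto simp: q_def)
  then have "cycle (e # q)"
    using e by (auto simp: cycle_def apath_def awalk_Cons_iff)
  moreover have "set (e # q) \<subseteq> set p" using q(2) p by auto
  ultimately show thesis by (rule that)
qed

lemma awalk_leaves:
  assumes "awalk u p v" "u \<in> A" "v \<notin> A"
  shows "\<exists>e\<in>set p. tail G e \<in> A \<and> head G e \<notin> A"
  using assms by (induction p arbitrary: u) (auto simp: awalk_simps)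

lemma awalk_stays:
  assumes "awalk u p v" "\<And>e. e \<in> set p \<Longrightarrow> tail G e \<in> A \<longleftrightarrow> head G e \<in> A" "e \<in> set p"
  shows "tail G e \<in> A \<longleftrightarrow> u \<in> A"
  using assms by (induction p arbitrary: u) (auto simp: awalk_simps)

text \<open>Cut open at \<open>e\<close>, the closed walk leads from the head of \<open>e\<close> to
  its tail and so crosses the boundary of \<open>A\<close> opposite to \<open>e\<close>. The arc
  \<open>e\<close> itself provides the other direction.\<close>

lemma closed_awalk_leaves_and_enters:
  assumes "awalk u p u" "e \<in> set p" "tail G e \<in> A \<longleftrightarrow> head G e \<notin> A"
  shows "\<exists>x\<in>set p. tail G x \<in> A \<and> head G x \<notin> A" "\<exists>x\<in>set p. tail G x \<notin> A \<and> head G x \<in> A"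
proof -
  obtain q r where p: "p = q @ e # r" using assms(2) by (auto dest: split_list)
  then have "awalk (head G e) (r @ q) (tail G e)"
    using assms(1)
    by (auto simp: awalk_append_iff_ex awalk_Cons_iff simp del: awalk_append_iff)
  note leaves = awalk_leaves[OF this]
  show "\<exists>x\<in>set p. tail G x \<in> A \<and> head G x \<notin> A" "\<exists>x\<in>set p. tail G x \<notin> A \<and> head G x \<in> A"
    using assms(3) leaves[of A] leaves[of "- A"] p by auto
qed

lemma subgraph_induce: "A \<subseteq> verts G \<Longrightarrow> subgraph (G \<restriction> A) G"
  by (intro induced_imp_subgraph induced_induce)

lemma weakly_acyclic_induce:
  assumes "weakly_acyclic G m" "A \<subseteq> verts G"
  shows "weakly_acyclic (G \<restriction> A) m"
  using assms subgraph_cycle[OF subgraph_induce] by (auto simp: weakly_acyclic_def)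

lemma awalk_induceI:
  assumes "awalk u p v" "u \<in> A" "\<And>e. e \<in> set p \<Longrightarrow> tail G e \<in> A \<and> head G e \<in> A"
  shows "pre_digraph.awalk (G \<restriction> A) u p v"
proof -
  interpret H: wf_digraph "G \<restriction> A" by (rule wellformed_induce_subgraph)
  show ?thesis using assms
    by (induction p arbitrary: u) (auto simp: awalk_simps H.awalk_simps)
qed

lemma cycle_induceI:
  assumes "cycle p" "\<And>e. e \<in> set p \<Longrightarrow> tail G e \<in> A \<and> head G e \<in> A"
  shows "pre_digraph.cycle (G \<restriction> A) p"
proof -
  obtain u where u: "awalk u p u" "distinct (tl (awalk_verts u p))" "p \<noteq> []"
    using assms(1) by (auto simp: cycle_def)
  then have "u \<in> A" using assms(2) by (cases p) (auto simp: awalk_Cons_iff)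
  with u assms(2) show ?thesis
    by (auto simp: pre_digraph.cycle_def compatible_awalk_verts[OF compatible_induce_subgraph]
        intro!: exI[of _ u] awalk_induceI)
qed

text \<open>Traced backwards from its end in \<open>A\<close>, the walk could only get outside
  \<open>A\<close> through an arc entering \<open>A\<close>.\<close>

lemma awalk_induce_if_not_entering:
  assumes "awalk u p v" "v \<in> A" "\<And>e. e \<in> set p \<Longrightarrow> head G e \<in> A \<Longrightarrow> tail G e \<in> A"
  shows "pre_digraph.awalk (G \<restriction> A) u p v"
proof -
  interpret H: wf_digraph "G \<restriction> A" by (rule wellformed_induce_subgraph)
  show ?thesis using assms
  proof (induction p arbitrary: u)
    case (Cons e p)
    then have "H.awalk (head G e) p v" by (auto simp: awalk_Cons_iff)
    moreover from this have "head G e \<in> A" by (auto dest: H.awalk_hd_in_verts)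
    ultimately show ?case using Cons.prems by (auto simp: awalk_Cons_iff H.awalk_Cons_iff)
  qed (auto simp: awalk_simps H.awalk_simps)
qed

text \<open>The walk must use \<open>f\<close>, the only entry to \<open>A\<close>. After its last
  use of \<open>f\<close> there is no further entry, so this remainder stays inside
  \<open>A\<close>.\<close>

lemma awalk_induce_from_entry:
  assumes "awalk u p v" "u \<notin> A" "v \<in> A"
    and entry: "\<And>e. e \<in> arcs G \<Longrightarrow> tail G e \<notin> A \<Longrightarrow> head G e \<in> A \<Longrightarrow> e = f"
  shows "\<exists>q. pre_digraph.awalk (G \<restriction> A) (head G f) q v"
proof -
  have arcs: "set p \<subseteq> arcs G" using assms(1) by auto
  have "f \<in> set p" using awalk_leaves[of u p v "- A"] assms arcs by auto
  then obtain q r where p: "p = q @ f # r" and r: "f \<notin> set r"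
    by (auto dest: split_list_last)
  then have "awalk (head G f) r v" using assms(1)
    by (auto simp: awalk_append_iff_ex awalk_Cons_iff simp del: awalk_append_iff)
  then have "pre_digraph.awalk (G \<restriction> A) (head G f) r v"
    using r p arcs entry by (intro awalk_induce_if_not_entering assms) auto
  then show ?thesis by blast
qed

end

section \<open>Symmetry of walks and of induced subgraphs\<close>

context skew_symmetric_graph
begin

lemma awalk_mate:
  assumes "awalk u p v"
  shows "awalk (nmate v) (rev (map amate p)) (nmate u)"
  using assms
  by (induction p arbitrary: u)
    (auto simp: awalk_simps awalk_snoc_iff nmate_in_verts amate_in_arcs tail_amate head_amate
      simp del: awalk_append_iff)

lemma regular_mate:
  assumes "regular amate p" "set p \<subseteq> arcs G"
  shows "regular amate (rev (map amate p))"
  using assms by (auto simp: regular_def subset_iff) (metis amate_amate)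

text \<open>A one-sided disjointness condition suffices: if an arc of \<open>p\<close> had its mate
  in \<open>q\<close>, taking the mate again would lead back into \<open>p\<close>.\<close>

lemma regular_append:
  assumes "regular amate p" "regular amate q" "set p \<subseteq> arcs G"
    and "\<And>x. x \<in> set q \<Longrightarrow> amate x \<notin> set p"
  shows "regular amate (p @ q)"
  unfolding regular_def
proof
  fix e assume e: "e \<in> set (p @ q)"
  show "amate e \<notin> set (p @ q)"
  proof (cases "e \<in> set p")
    case True
    then have "amate (amate e) \<in> set p" using assms(3) amate_amate by auto
    then show ?thesis using True assms(1,4) by (auto simp: regular_def)
  next
    case False
    then show ?thesis using e assms(2,4) by (auto simp: regular_def)
  qed
qed

lemma skew_symmetric_induce:
  assumes "A \<subseteq> verts G" "self_symmetric nmate A"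
  shows "skew_symmetric_graph (G \<restriction> A) nmate amate"
proof -
  have nA: "nmate x \<in> A" if "x \<in> A" for x using assms that by (auto simp: self_symmetric_def)
  have "finite A" using assms(1) finite_verts by (rule finite_subset)
  then show ?thesis
    using assms(1) nA
    by unfold_locales
      (auto simp: amate_in_arcs tail_amate head_amate nmate_nmate nmate_neq amate_amate amate_neq)
qed

text \<open>Walks in \<open>G\<close> from the tail of \<open>f\<close> into \<open>A\<close> end in
  walks inside \<open>A\<close> that start at the head of \<open>f\<close>, so every node of
  \<open>A\<close> is reached from there. The mate of such a walk to \<open>nmate x\<close> leads
  from \<open>x\<close> to the mate of the head of \<open>f\<close>.\<close>

lemma s_connected_induce:
  assumes "strongly_connected G" "A \<subseteq> verts G" "self_symmetric nmate A"
    and f: "f \<in> arcs G" "tail G f \<notin> A" "head G f \<in> A"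
    and entry: "\<And>e. e \<in> arcs G \<Longrightarrow> tail G e \<notin> A \<Longrightarrow> head G e \<in> A \<Longrightarrow> e = f"
  shows "s_connected (G \<restriction> A) nmate (head G f)"
proof -
  interpret H: skew_symmetric_graph "G \<restriction> A" nmate amate
    by (rule skew_symmetric_induce[OF assms(2,3)])
  have from_head: "\<exists>q. H.awalk (head G f) q x" if "x \<in> A" for x
  proof -
    have "tail G f \<rightarrow>\<^sup>* x"
      using assms(1,2) f(1) that by (auto simp: strongly_connected_def)
    then obtain p where "awalk (tail G f) p x" by (auto simp: reachable_awalk)
    from awalk_induce_from_entry[OF this f(2) that entry] show ?thesis .
  qed
  have "\<exists>p. H.awalk (head G f) p (nmate (head G f)) \<and> x \<in> set (H.awalk_verts (head G f) p)"
    if x: "x \<in> A" for x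
  proof -
    obtain q where q: "H.awalk (head G f) q x" using from_head x by blast
    have "nmate x \<in> A" using H.nmate_in_verts x by simp
    then obtain r where "H.awalk (head G f) r (nmate x)" using from_head by blast
    from H.awalk_mate[OF this] have r: "H.awalk x (rev (map amate r)) (nmate (head G f))"
      using H.nmate_nmate x by simp
    have "x \<in> set (H.awalk_verts (head G f) (q @ rev (map amate r)))"
      using H.set_awalk_verts_append[OF q r] H.hd_in_awalk_verts(1)[OF r] by simp
    with H.awalk_appendI[OF q r] show ?thesis by blast
  qed
  then show ?thesis using f(3) by (auto simp: s_connected_def)
qed

section \<open>From strong separators to strong connectivity and weak acyclicity\<close>

lemma strong_separator_imp:
  assumes "strong_separator G nmate amate A B"
  shows "strongly_connected G \<and> weakly_acyclic G amate"
proof -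
  obtain a b e where AB: "A \<union> B = verts G" "A \<inter> B = {}"
    and sym: "self_symmetric nmate A" "self_symmetric nmate B"
    and ab: "a \<in> A" "b \<in> B" and e: "e \<in> arcs G" "tail G e = nmate a" "head G e = b"
    and crossing: "arcs_between G A B = {e, amate e}"
    and wa: "weakly_acyclic (G \<restriction> A) amate" "weakly_acyclic (G \<restriction> B) amate"
    and sc: "s_connected (G \<restriction> A) nmate a" "s_connected (G \<restriction> B) nmate b"
    using assms unfolding strong_separator_def by blast
  have nA: "nmate a \<in> A" using sym(1) ab(1) by (auto simp: self_symmetric_def)
  have through: "s \<rightarrow>\<^sup>* x \<and> x \<rightarrow>\<^sup>* nmate s"
    if conn: "s_connected (G \<restriction> C) nmate s" and C: "C \<subseteq> verts G" and x: "x \<in> C" for C s x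
  proof -
    interpret H: wf_digraph "G \<restriction> C" by (rule wellformed_induce_subgraph)
    have "x \<in> verts (G \<restriction> C)" using x by simp
    then obtain p where "H.awalk s p (nmate s)" "x \<in> set (H.awalk_verts s p)"
      using conn unfolding s_connected_def by blast
    then have "awalk s p (nmate s)" "x \<in> set (awalk_verts s p)"
      using subgraph_awalk_imp_awalk[OF _ subgraph_induce[OF C]]
      by (auto simp: compatible_awalk_verts[OF compatible_induce_subgraph])
    then show ?thesis
      using awalk_verts_reachable_from awalk_verts_reachable_to by blast
  qed
  have thrA: "a \<rightarrow>\<^sup>* x \<and> x \<rightarrow>\<^sup>* nmate a" if "x \<in> A" for x using through[OF sc(1)] that AB by auto
  have thrB: "b \<rightarrow>\<^sup>* x \<and> x \<rightarrow>\<^sup>* nmate b" if "x \<in> B" for x using through[OF sc(2)] that AB by auto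
  have "nmate a \<rightarrow>\<^sup>* b" using e by (metis reachable_awalkI arc_implies_awalk)
  moreover have "nmate b \<rightarrow>\<^sup>* a"
    using amate_in_arcs[OF e(1)] tail_amate[OF e(1)] head_amate[OF e(1)] e nmate_nmate ab AB
    by (metis reachable_awalkI arc_implies_awalk UnI1)
  \<comment> \<open>The two sides form a round trip: from \<open>a\<close> through \<open>A\<close>
    to its mate, along \<open>e\<close> to \<open>b\<close>, through \<open>B\<close> to the mate of
    \<open>b\<close>, and along \<open>amate e\<close> back to \<open>a\<close>.\<close>
  ultimately have "x \<rightarrow>\<^sup>* a \<and> a \<rightarrow>\<^sup>* x" if "x \<in> verts G" for x
    using that thrA thrB AB ab nA by (metis Un_iff reachable_trans)
  then have "strongly_connected G"
    using AB ab by (intro strongly_connectedI) (auto intro: reachable_trans)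
  moreover have "\<not> regular amate p" if "cycle p" for p
  proof
    assume reg: "regular amate p"
    obtain u where u: "awalk u p u" "p \<noteq> []" using \<open>cycle p\<close> by (auto simp: cycle_def)
    then have arcs: "set p \<subseteq> arcs G" by auto
    \<comment> \<open>A circuit that changes sides crosses in both directions. The only crossing
      arcs are \<open>e\<close> and its mate, so it would contain both and not be regular.\<close>
    have no_crossing: "tail G x \<in> A \<longleftrightarrow> head G x \<in> A" if "x \<in> set p" for x
    proof (rule ccontr)
      assume "\<not> ?thesis"
      then have "tail G x \<in> A \<longleftrightarrow> head G x \<notin> A" by blast
      from closed_awalk_leaves_and_enters[OF u(1) that this]
      obtain y z where yz: "y \<in> set p" "tail G y \<in> A" "head G y \<notin> A"
        "z \<in> set p" "tail G z \<notin> A" "head G z \<in> A" by blast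
      have "y \<in> arcs G" "z \<in> arcs G" using yz arcs by auto
      then have "tail G z \<in> B" "head G y \<in> B"
        using yz AB(1) by (metis Un_iff tail_in_verts, metis Un_iff head_in_verts)
      then have "y \<in> arcs_between G A B" "z \<in> arcs_between G A B" "y \<noteq> z"
        using yz \<open>y \<in> arcs G\<close> \<open>z \<in> arcs G\<close> by (auto simp: arcs_between_def)
      then have "amate y = z \<or> amate z = y" using crossing by auto
      then show False using reg yz by (auto simp: regular_def)
    qed
    have stay: "tail G x \<in> A \<longleftrightarrow> u \<in> A" "head G x \<in> A \<longleftrightarrow> u \<in> A" if "x \<in> set p" for x
      using awalk_stays[OF u(1) no_crossing that] no_crossing[OF that] by simp_all
    show False
    proof (cases "u \<in> A")
      case True
      then have "pre_digraph.cycle (G \<restriction> A) p" using stay by (intro cycle_induceI that) auto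
      with wa(1) reg show False by (auto simp: weakly_acyclic_def)
    next
      case False
      have "tail G x \<in> B \<and> head G x \<in> B" if "x \<in> set p" for x
        using stay[OF that] False arcs that AB(1) by (metis Un_iff head_in_verts subsetD tail_in_verts)
      then have "pre_digraph.cycle (G \<restriction> B) p" by (intro cycle_induceI that) auto
      with wa(2) reg show False by (auto simp: weakly_acyclic_def)
    qed
  qed
  ultimately show ?thesis by (auto simp: weakly_acyclic_def)
qed

section \<open>Regular walks and the order on arcs\<close>

definition regular_walk :: "'b \<Rightarrow> 'b list \<Rightarrow> 'a \<Rightarrow> bool" where
  "regular_walk e p v \<longleftrightarrow> awalk (tail G e) (e # p) v \<and> regular amate (e # p)"

text \<open>The shape \<open>p @ [f]\<close> puts \<open>f\<close> at a later position than
  \<open>e\<close>. Only the arcs \<open>q\<close> that follow \<open>f\<close> must avoid the walk,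
  since \<open>f\<close> lies on it.\<close>

definition arc_before :: "'b \<Rightarrow> 'b \<Rightarrow> bool" where
  "arc_before e f \<longleftrightarrow> (\<exists>p. regular_walk e (p @ [f]) (head G f) \<and>
     (\<forall>q v. regular_walk f q v \<longrightarrow>
        (\<forall>x\<in>set q. x \<notin> set (e # p @ [f]) \<and> amate x \<notin> set (e # p @ [f]))))"

definition reach_arcs :: "'b \<Rightarrow> 'b set" where
  "reach_arcs e = {g. \<exists>p. regular_walk e (p @ [g]) (head G g)}"

lemma regular_walk_arcs: "regular_walk e p v \<Longrightarrow> e \<in> arcs G \<and> set p \<subseteq> arcs G"
  by (auto simp: regular_walk_def awalk_Cons_iff)

lemma regular_walk_prefix:
  assumes "regular_walk e (p @ [x] @ q) v"
  shows "regular_walk e (p @ [x]) (head G x)" "regular_walk e p (tail G x)"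
  using assms
  by (auto simp: regular_walk_def awalk_append_iff_ex awalk_simps regular_def
      simp del: awalk_append_iff)

lemma in_reach_arcs:
  assumes "regular_walk e p v" "x \<in> set p"
  shows "x \<in> reach_arcs e"
proof -
  obtain q r where "p = q @ [x] @ r" using assms(2) by (auto dest: split_list)
  then show ?thesis using regular_walk_prefix(1)[of e q x r v] assms(1)
    by (auto simp: reach_arcs_def)
qed

lemma mate_notin_reach_arcs: "amate e \<notin> reach_arcs e"
  by (auto simp: reach_arcs_def regular_walk_def regular_def)

context
  assumes weakly_acyclic: "weakly_acyclic G amate"
begin

text \<open>Weak acyclicity only speaks of node-simple circuits, but a circuit extracted from a
  closed walk uses arcs of that walk only and inherits its regularity.\<close>

lemma no_regular_closed_awalk:
  assumes "awalk u p u" "regular amate p"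
  shows "p = []"
proof (rule ccontr)
  assume "p \<noteq> []"
  then obtain q where "cycle q" "set q \<subseteq> set p" using closed_awalk_imp_cycle assms(1) by blast
  with regular_mono[OF assms(2)] weakly_acyclic show False by (auto simp: weakly_acyclic_def)
qed

text \<open>The part from one occurrence of an arc up to just before the next would be a regular
  closed walk.\<close>

lemma distinct_regular_awalk:
  assumes "awalk u p v" "regular amate p"
  shows "distinct p"
proof (rule ccontr)
  assume "\<not> distinct p"
  then obtain q r s x where p: "p = q @ [x] @ r @ [x] @ s" by (auto dest: not_distinct_decomp)
  then have "awalk (tail G x) (x # r) (tail G x)" using assms(1)
    by (auto simp: awalk_append_iff_ex awalk_simps simp del: awalk_append_iff)
  moreover have "regular amate (x # r)" by (rule regular_mono[OF assms(2)]) (auto simp: p)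
  ultimately show False using no_regular_closed_awalk by blast
qed

lemma notin_reach_arcs: "e \<notin> reach_arcs e"
  by (auto simp: reach_arcs_def regular_walk_def dest!: distinct_regular_awalk)

lemma not_arc_before_self: "\<not> arc_before e e"
  using notin_reach_arcs by (auto simp: arc_before_def reach_arcs_def)

lemma arc_before_trans:
  assumes "arc_before e f" "arc_before f g"
  shows "arc_before e g"
proof -
  obtain p where p: "regular_walk e (p @ [f]) (head G f)"
    and p_avoid: "\<And>q v x. regular_walk f q v \<Longrightarrow> x \<in> set q \<Longrightarrow>
      x \<notin> set (e # p @ [f]) \<and> amate x \<notin> set (e # p @ [f])"
    using assms(1) unfolding arc_before_def by blast
  obtain q where q: "regular_walk f (q @ [g]) (head G g)"
    and q_avoid: "\<And>r v x. regular_walk g r v \<Longrightarrow> x \<in> set r \<Longrightarrow>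
      x \<notin> set (f # q @ [g]) \<and> amate x \<notin> set (f # q @ [g])"
    using assms(2) unfolding arc_before_def by blast
  have concat: "regular_walk d (p1 @ [x] @ p2) v"
    if "regular_walk d (p1 @ [x]) (head G x)" "regular_walk x p2 v"
      "\<And>y. y \<in> set p2 \<Longrightarrow> amate y \<notin> set (d # p1 @ [x])" for d p1 x p2 v
  proof -
    have "awalk (tail G d) ((d # p1 @ [x]) @ p2) v"
      using that(1,2) by (auto simp: regular_walk_def awalk_Cons_iff intro: awalk_appendI
          simp del: awalk_append_iff append_Cons append.simps append_assoc)
    moreover have "regular amate ((d # p1 @ [x]) @ p2)"
      using that regular_walk_arcs[OF that(1)]
      by (intro regular_append) (auto simp: regular_walk_def regular_def)
    ultimately show ?thesis by (simp add: regular_walk_def)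
  qed
  have "regular_walk e (p @ [f] @ q @ [g]) (head G g)"
    using concat[OF p q] p_avoid[OF q] by simp
  moreover have "x \<notin> set (e # p @ [f] @ q @ [g]) \<and> amate x \<notin> set (e # p @ [f] @ q @ [g])"
    if r: "regular_walk g r v" and x: "x \<in> set r" for r v x
  proof -
    \<comment> \<open>Seen from \<open>f\<close>, the arcs of \<open>r\<close> belong to a regular
      walk starting with \<open>f\<close>, so they avoid the first walk and its mates. Being
      preceded by \<open>g\<close>, they also avoid the second.\<close>
    have "regular_walk f (q @ [g] @ r) v" using concat[OF q r] q_avoid[OF r] by simp
    from p_avoid[OF this, of x] q_avoid[OF r x] x show ?thesis by auto
  qed
  ultimately show ?thesis unfolding arc_before_def
    by (intro exI[of _ "p @ [f] @ q"]) simp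
qed

lemma maximal_arc_exists:
  assumes "arcs G \<noteq> {}"
  obtains f where "f \<in> arcs G" "\<And>g. \<not> arc_before f g"
proof -
  \<comment> \<open>The pairs are reversed, so that a minimal element of the well-founded
    \<open>R\<close> is a maximal arc.\<close>
  define R where "R = {(g, f). f \<in> arcs G \<and> g \<in> arcs G \<and> arc_before f g}"
  have "R \<subseteq> arcs G \<times> arcs G" by (auto simp: R_def)
  then have "finite R" by (rule finite_subset) simp
  moreover have "trans R" by (auto simp: R_def trans_def intro: arc_before_trans)
  then have "acyclic R" by (simp add: acyclic_irrefl irrefl_def R_def not_arc_before_self)
  ultimately have "wf R" by (rule finite_acyclic_wf)
  then obtain f where f: "f \<in> arcs G" "\<And>g. (g, f) \<in> R \<Longrightarrow> g \<notin> arcs G"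
    using assms by (metis all_not_in_conv wfE_min)
  have "\<not> arc_before f g" for g
  proof
    assume before: "arc_before f g"
    then obtain p where "regular_walk f (p @ [g]) (head G g)" by (auto simp: arc_before_def)
    then have "g \<in> arcs G" using regular_walk_arcs by fastforce
    with before f(1) f(2)[of g] show False by (simp add: R_def)
  qed
  with f(1) show thesis by (rule that)
qed

section \<open>Closure under mates of the arcs reachable from a maximal arc\<close>

lemma mate_reach_arcs_if_maximal:
  assumes max: "\<And>g. \<not> arc_before f g" and "g \<in> reach_arcs f"
  shows "amate g \<in> reach_arcs f"
proof -
  obtain p where p: "regular_walk f (p @ [g]) (head G g)"
    using assms(2) by (auto simp: reach_arcs_def)
  define S where "S = f # p @ [g]"
  have S: "awalk (tail G f) S (head G g)" "regular amate S" "set S \<subseteq> arcs G"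
    using p regular_walk_arcs[OF p] by (auto simp: S_def regular_walk_def awalk_simps)
  let ?hit = "\<lambda>x. x \<in> set S \<or> amate x \<in> set S"
  obtain q v x0 where "regular_walk g q v" "x0 \<in> set q" "?hit x0"
    using max[of g] p by (auto simp: arc_before_def S_def)
  \<comment> \<open>Taking the first hit \<open>x\<close> keeps \<open>q1\<close> disjoint from
    \<open>S\<close> and its mates, which makes the concatenations below regular.\<close>
  then obtain q1 x q2 where q: "regular_walk g (q1 @ [x] @ q2) v"
    and hit: "?hit x" and first: "\<forall>y\<in>set q1. \<not> ?hit y"
    using split_list_first_prop[of q ?hit] by auto
  have gq1x: "regular_walk g (q1 @ [x]) (head G x)" and gq1: "regular_walk g q1 (tail G x)"
    using regular_walk_prefix[OF q] by auto
  have q1: "awalk (head G g) q1 (tail G x)" "regular amate (g # q1)" "set (g # q1) \<subseteq> arcs G"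
    using gq1 regular_walk_arcs[OF gq1] by (auto simp: regular_walk_def awalk_Cons_iff)
  have x: "x \<in> arcs G" using regular_walk_arcs[OF gq1x] by simp
  \<comment> \<open>Otherwise the part of \<open>S\<close> from \<open>x\<close> to
    \<open>g\<close>, continued by \<open>q1\<close>, would be a regular closed walk.\<close>
  have "x \<notin> set S"
  proof
    assume "x \<in> set S"
    then obtain s1 s2 where s: "S = s1 @ x # s2" by (auto dest: split_list)
    then have "awalk (tail G x) (x # s2) (head G g)" using S(1)
      by (auto simp: awalk_append_iff_ex awalk_simps simp del: awalk_append_iff)
    then have "awalk (tail G x) ((x # s2) @ q1) (tail G x)" using q1(1) by (rule awalk_appendI)
    moreover have "regular amate ((x # s2) @ q1)"
    proof (rule regular_append)
      show "regular amate (x # s2)" by (rule regular_mono[OF S(2)]) (auto simp: s)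
      show "regular amate q1" by (rule regular_mono[OF q1(2)]) auto
      show "set (x # s2) \<subseteq> arcs G" using S(3) s by auto
      show "amate z \<notin> set (x # s2)" if "z \<in> set q1" for z using first that s by auto
    qed
    ultimately show False using no_regular_closed_awalk by blast
  qed
  \<comment> \<open>Hence the mate \<open>y\<close> of \<open>x\<close> is on \<open>S\<close>. The
    new walk follows \<open>S\<close> up to \<open>y\<close> and then the mate of
    \<open>g # q1\<close>, which starts at the head of \<open>y\<close> and has
    \<open>amate g\<close> as its last arc.\<close>
  define y where "y = amate x"
  have y: "y \<in> set S" "y \<in> arcs G" "head G y = nmate (tail G x)"
    using hit \<open>x \<notin> set S\<close> x by (auto simp: y_def amate_in_arcs head_amate)
  obtain s1 s2 where s: "S = s1 @ y # s2" using y(1) by (auto dest: split_list)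
  let ?r = "rev (map amate (g # q1))"
  have "awalk (tail G f) (s1 @ [y]) (head G y)" using S(1)
    by (auto simp: s awalk_append_iff_ex awalk_simps simp del: awalk_append_iff)
  moreover have "awalk (head G y) ?r (nmate (tail G g))"
    using awalk_mate[of "tail G g" "g # q1"] gq1 y(3) by (simp add: regular_walk_def)
  ultimately have walk: "awalk (tail G f) ((s1 @ [y]) @ ?r) (nmate (tail G g))"
    by (rule awalk_appendI)
  \<comment> \<open>As \<open>g\<close> is the last arc of \<open>S\<close> and \<open>S\<close>
    repeats no arc, only \<open>y = g\<close> is critical. Then \<open>g\<close> would be the mate
    of \<open>x\<close>, although both lie on one regular walk.\<close>
  have "g \<notin> set (s1 @ [y])"
  proof
    assume g: "g \<in> set (s1 @ [y])"
    show False
    proof (cases s2 rule: rev_cases)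
      case Nil
      then have "g = amate x" using s by (simp add: S_def y_def)
      then show False using gq1x by (auto simp: regular_walk_def regular_def amate_amate x)
    next
      case (snoc s' z)
      then have "g \<in> set s2" using s by (auto simp: S_def)
      with g distinct_regular_awalk[OF S(1,2)] show False by (auto simp: s)
    qed
  qed
  then have disj: "z \<notin> set (s1 @ [y])" if "z \<in> set (g # q1)" for z
    using that first by (auto simp: s)
  have "regular amate ((s1 @ [y]) @ ?r)"
  proof (rule regular_append)
    show "regular amate (s1 @ [y])" by (rule regular_mono[OF S(2)]) (auto simp: s)
    show "regular amate ?r" using q1 by (intro regular_mate)
    show "set (s1 @ [y]) \<subseteq> arcs G" using S(3) s by auto
    show "amate z \<notin> set (s1 @ [y])" if z: "z \<in> set ?r" for z
    proof -
      obtain w where w: "w \<in> set (g # q1)" "z = amate w" using z by auto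
      then show ?thesis using disj[of w] q1(3) amate_amate[of w] by auto
    qed
  qed
  moreover obtain s' where "s1 @ [y] = f # s'" using s by (cases s1) (auto simp: S_def)
  ultimately have "regular_walk f (s' @ ?r) (nmate (tail G g))"
    using walk unfolding regular_walk_def by simp
  from in_reach_arcs[OF this, of "amate g"] show ?thesis by simp
qed

section \<open>Construction of a strong separator from a maximal arc\<close>

lemma strong_separator_exists:
  assumes sc: "strongly_connected G"
  shows "\<exists>A B. strong_separator G nmate amate A B"
proof -
  have out: "\<exists>e\<in>arcs G. tail G e = v" if v: "v \<in> verts G" for v
  proof -
    have "v \<rightarrow>\<^sup>* nmate v" using sc v nmate_in_verts by auto
    then obtain p where "awalk v p (nmate v)" by (auto simp: reachable_awalk)
    then show ?thesis using nmate_neq[OF v] by (cases p) (auto simp: awalk_simps)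
  qed
  have "arcs G \<noteq> {}" using out sc by (fastforce simp: strongly_connected_def)
  then obtain f where f: "f \<in> arcs G" and max: "\<And>g. \<not> arc_before f g"
    by (rule maximal_arc_exists) blast
  define Y where "Y = reach_arcs f"
  \<comment> \<open>The arc \<open>f\<close> is inserted because it is not in \<open>Y\<close>,
    while its head is to be the entry node of \<open>B\<close>.\<close>
  define B where "B = head G ` insert f Y"
  define A where "A = verts G - B"
  have Y_arcs: "Y \<subseteq> arcs G" by (auto simp: Y_def reach_arcs_def dest!: regular_walk_arcs)
  have Y_mate: "amate g \<in> Y" if "g \<in> Y" for g
    using that mate_reach_arcs_if_maximal[OF max] by (simp add: Y_def)
  have fY: "f \<notin> Y" "amate f \<notin> Y" using notin_reach_arcs mate_notin_reach_arcs by (auto simp: Y_def)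
  have BV: "B \<subseteq> verts G" using f Y_arcs by (auto simp: B_def)
  have walk_to: "\<exists>p. regular_walk f p x" if "x \<in> B" for x
  proof -
    have "regular_walk f [] (head G f)"
      using f amate_neq by (auto simp: regular_walk_def awalk_simps regular_def)
    then show ?thesis using that by (auto simp: B_def Y_def reach_arcs_def)
  qed
  have tail_f: "tail G f \<notin> B"
  proof
    assume "tail G f \<in> B"
    then obtain p where "regular_walk f p (tail G f)" using walk_to by blast
    then show False using no_regular_closed_awalk by (auto simp: regular_walk_def)
  qed
  have leaving: "h \<in> Y \<or> h = amate f" if h: "h \<in> arcs G" "tail G h \<in> B" for h
  proof -
    obtain p where p: "regular_walk f p (tail G h)" using walk_to h by blast
    show ?thesis
    \<comment> \<open>If neither \<open>h\<close> nor its mate is on the walk, \<open>h\<close>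
      extends it regularly. Otherwise \<open>h\<close> or its mate is in \<open>Y\<close> or equals
      \<open>f\<close>, and \<open>h = f\<close> is impossible because the tail of \<open>f\<close>
      is outside \<open>B\<close>.\<close>
    proof (cases "h \<in> set (f # p) \<or> amate h \<in> set (f # p)")
      case True
      then show ?thesis using in_reach_arcs[OF p] Y_mate tail_f h amate_amate
        unfolding Y_def by (metis set_ConsD)
    next
      case False
      then have "regular_walk f (p @ [h]) (head G h)"
        using p h amate_neq[OF h(1)] regular_append[of "f # p" "[h]"]
          awalk_appendI[of "tail G f" "f # p" "tail G h" "[h]"]
        by (auto simp: regular_walk_def awalk_simps regular_def simp del: awalk_append_iff)
      then show ?thesis by (auto simp: Y_def reach_arcs_def)
    qed
  qed
  \<comment> \<open>The tail of \<open>g\<close> is the head of the arc preceding \<open>g\<close>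
    on a regular walk, and that arc is \<open>f\<close> or in \<open>Y\<close>.\<close>
  have tail_Y: "tail G g \<in> B" if "g \<in> Y" for g
  proof -
    obtain p where p: "regular_walk f (p @ [g]) (head G g)"
      using \<open>g \<in> Y\<close> by (auto simp: Y_def reach_arcs_def)
    from regular_walk_prefix(2)[of f p g "[]"] p have "regular_walk f p (tail G g)" by simp
    then show ?thesis
      using in_reach_arcs[OF p]
      by (cases p rule: rev_cases)
        (auto simp: B_def Y_def regular_walk_def awalk_simps awalk_snoc_iff
          simp del: awalk_append_iff append_Cons simp flip: append_Cons)
  qed
  have B_mate: "nmate x \<in> B" if x: "x \<in> B" for x
  proof -
    from x consider "x = head G f" | g where "g \<in> Y" "x = head G g" by (auto simp: B_def)
    then show ?thesis
    proof cases
      case 1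
      \<comment> \<open>Since \<open>f\<close> need not have its mate in \<open>Y\<close>, an arc
        \<open>h\<close> out of its head is used instead. It is not \<open>amate f\<close>, which
        starts at the mate of that head, so \<open>h\<close> and its mate are in \<open>Y\<close>,
        and \<open>amate h\<close> ends at \<open>nmate x\<close>.\<close>
      then obtain h where h: "h \<in> arcs G" "tail G h = x" using out f by (metis head_in_verts)
      have "h \<noteq> amate f" using h 1 tail_amate[OF f] nmate_neq f by fastforce
      then have "amate h \<in> Y" using leaving[OF h(1)] h x Y_mate by blast
      then show ?thesis using head_amate[OF h(1)] h(2) by (force simp: B_def)
    next
      case 2
      then show ?thesis using tail_Y[OF Y_mate[OF 2(1)]] tail_amate Y_arcs by auto
    qed
  qed
  have sym: "self_symmetric nmate C" if "C \<subseteq> verts G" "\<And>x. x \<in> C \<Longrightarrow> nmate x \<in> C" for C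
    using that nmate_nmate unfolding self_symmetric_def by (auto simp: image_iff) (metis subsetD)
  have A_mate: "nmate x \<in> A" if "x \<in> A" for x
    using that B_mate[of "nmate x"] by (auto simp: A_def nmate_in_verts nmate_nmate)
  have AV: "A \<subseteq> verts G" by (auto simp: A_def)
  have symA: "self_symmetric nmate A" and symB: "self_symmetric nmate B"
    using sym[OF AV A_mate] sym[OF BV B_mate] by auto
  \<comment> \<open>An arc of \<open>Y\<close> has its head in \<open>B\<close>, so only
    \<open>amate f\<close> can leave; by symmetry only \<open>f\<close> can enter.\<close>
  have leaves_B: "h = amate f" if "h \<in> arcs G" "tail G h \<in> B" "head G h \<notin> B" for h
    using leaving[OF that(1,2)] that(3) by (auto simp: B_def)
  have enters_B: "h = f" if h: "h \<in> arcs G" "tail G h \<notin> B" "head G h \<in> B" for h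
  proof -
    have "head G (amate h) \<notin> B"
      using B_mate[of "nmate (tail G h)"] h by (auto simp: head_amate nmate_nmate)
    then have "amate h = amate f"
      using leaves_B[of "amate h"] h B_mate by (auto simp: tail_amate amate_in_arcs)
    then show ?thesis using amate_amate h(1) f by metis
  qed
  have head_f: "head G f \<in> B" by (simp add: B_def)
  have mate_f: "tail G (amate f) \<in> B" "head G (amate f) \<in> A"
    using f head_f tail_f B_mate A_mate[of "tail G f"]
    by (auto simp: tail_amate head_amate A_def)
  have "arcs_between G A B = {f, amate f}"
  proof (rule set_eqI)
    fix e
    have "e \<in> arcs_between G A B \<longleftrightarrow>
        e \<in> arcs G \<and> (tail G e \<notin> B \<and> head G e \<in> B \<or> tail G e \<in> B \<and> head G e \<notin> B)"
      by (auto simp: arcs_between_def A_def)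
    also have "\<dots> \<longleftrightarrow> e = f \<or> e = amate f"
      using f tail_f head_f mate_f amate_in_arcs[OF f] leaves_B[of e] enters_B[of e]
      unfolding A_def by blast
    finally show "e \<in> arcs_between G A B \<longleftrightarrow> e \<in> {f, amate f}" by simp
  qed
  moreover have "s_connected (G \<restriction> B) nmate (head G f)"
    using sc BV symB f tail_f head_f enters_B by (rule s_connected_induce)
  moreover have "s_connected (G \<restriction> A) nmate (head G (amate f))"
    using sc AV symA
  proof (rule s_connected_induce)
    show "amate f \<in> arcs G" using f by (rule amate_in_arcs)
    show "tail G (amate f) \<notin> A" "head G (amate f) \<in> A" using mate_f by (auto simp: A_def)
    show "e = amate f" if "e \<in> arcs G" "tail G e \<notin> A" "head G e \<in> A" for e
      using leaves_B that by (auto simp: A_def)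
  qed
  \<comment> \<open>The connecting arc of the separator is \<open>f\<close>, with \<open>b\<close>
    the head of \<open>f\<close> and \<open>a\<close> the head of \<open>amate f\<close>.\<close>
  moreover have "tail G f = nmate (head G (amate f))"
    using f by (simp add: head_amate nmate_nmate)
  moreover have "weakly_acyclic (G \<restriction> A) amate" "weakly_acyclic (G \<restriction> B) amate"
    using weakly_acyclic AV BV by (auto intro: weakly_acyclic_induce)
  moreover have "A \<union> B = verts G" "A \<inter> B = {}" using BV by (auto simp: A_def)
  ultimately have "strong_separator G nmate amate A B"
    unfolding strong_separator_def using f head_f mate_f(2) symA symB by blast
  then show ?thesis by blast
qed

end

end

theorem theorem3p2:
  fixes G :: "('a, 'b) pre_digraph" and nmate :: "'a \<Rightarrow> 'a" and amate :: "'b \<Rightarrow> 'b"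
  assumes "skew_symmetric_graph G nmate amate"
  shows "strongly_connected G \<and> weakly_acyclic G amate \<longleftrightarrow>
    (\<exists>A B. strong_separator G nmate amate A B)"
proof -
  interpret skew_symmetric_graph G nmate amate by fact
  show ?thesis using strong_separator_imp strong_separator_exists by blast
qed

end
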